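(* For every rational number $t$ with $0<t<\frac{9}{4}$, there exists a finite simple graph $G$ that is not hamiltonian and whose toughness satisfies $\tau(G)=t$.
   Context: All graphs are finite, undirected, without loops or multiple edges. A graph is hamiltonian if it contains a cycle through all of its vertices. For a graph $G$, $\omega(G)$ denotes the number of connected components, and for $S\subseteq V(G)$, $G\setminus S$ denotes the subgraph induced on $V(G)\setminus S$. A graph $G$ is $t$-tough if $|S|\ge t\,\omega(G\setminus S)$ for every $S\subseteq V(G)$ with $\omega(G\setminus S)>1$. The toughness $\tau(G)$ is the maximum $t$ for which $G$ is $t$-tough, i.e. the minimum of $|S|/\omega(G\setminus S)$ over all $S\subseteq V(G)$ with $\omega(G\setminus S)>1$; by convention $\tau(K_n)=\infty$. *)

theory Defs
  imports "Graph_Theory.Graph_Theory" "HOL-Library.Extended_Real"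
begin

text \<open>
  As in the Graph\_Theory entry, an undirected simple graph is a finite symmetric digraph without
  loops and parallel arcs (locales \<open>graph\<close> and \<open>pair_graph\<close>).
  The constant \<open>connected\<close> of that entry requires the vertex set to be nonempty and is
  qualified below, because there is also a topological constant of this name.
\<close>

definition components :: "('a, 'b) pre_digraph \<Rightarrow> ('a, 'b) pre_digraph set" where
  "components G = {H. pre_digraph.max_subgraph G Digraph_Component.connected H}"

definition num_components :: "('a, 'b) pre_digraph \<Rightarrow> nat" where
  "num_components G = card (components G)"

definition delete_vertices :: "('a, 'b) pre_digraph \<Rightarrow> 'a set \<Rightarrow> ('a, 'b) pre_digraph" where
  "delete_vertices G S = G \<restriction> (verts G - S)"

text \<open>
  In a symmetric digraph the closed walk \<open>a, b, a\<close> satisfies \<open>cycle\<close>, hence the bound on the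
  length. The vertices of a closed walk are the tails of its arcs.
\<close>
definition hamiltonian :: "('a, 'b) pre_digraph \<Rightarrow> bool" where
  "hamiltonian G \<longleftrightarrow>
     (\<exists>p. pre_digraph.cycle G p \<and> 3 \<le> length p \<and> tail G ` set p = verts G)"

definition tough :: "real \<Rightarrow> ('a, 'b) pre_digraph \<Rightarrow> bool" where
  "tough t G \<longleftrightarrow>
     (\<forall>S \<subseteq> verts G. num_components (delete_vertices G S) > 1 \<longrightarrow>
        real (card S) \<ge> t * real (num_components (delete_vertices G S)))"

text \<open>
  Extended reals make the infimum over the empty set, which occurs exactly for complete graphs,
  equal to infinity. That the infimum is otherwise a minimum, and that it is the largest \<open>t\<close> such
  that the graph is \<open>t\<close>-tough, is proved below.
\<close>
definition toughness :: "('a, 'b) pre_digraph \<Rightarrow> ereal" where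
  "toughness G =
     (INF S \<in> {S. S \<subseteq> verts G \<and> num_components (delete_vertices G S) > 1}.
        ereal (real (card S) / real (num_components (delete_vertices G S))))"

lemma tough_iff_le_toughness: "tough t G \<longleftrightarrow> ereal t \<le> toughness G"
  by (auto simp: tough_def toughness_def le_INF_iff pos_le_divide_eq)

lemma toughness_attained:
  assumes "finite (verts G)"
    and "S0 \<subseteq> verts G" "num_components (delete_vertices G S0) > 1"
  obtains S where "S \<subseteq> verts G" "num_components (delete_vertices G S) > 1"
    "toughness G = ereal (real (card S) / real (num_components (delete_vertices G S)))"
proof -
  let ?A = "{S. S \<subseteq> verts G \<and> num_components (delete_vertices G S) > 1}"
  let ?f = "\<lambda>S. ereal (real (card S) / real (num_components (delete_vertices G S)))"
  have "finite ?A" "?A \<noteq> {}"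
    using assms by auto
  then have fin: "finite (?f ` ?A)" and ne: "?f ` ?A \<noteq> {}"
    by blast+
  have "toughness G \<in> ?f ` ?A"
    unfolding toughness_def Min_Inf[OF fin ne, symmetric] by (rule Min_in[OF fin ne])
  then show thesis
    using that by auto
qed

lemma (in wf_digraph) connected_induce_subgraph:
  assumes "subgraph H G" "Digraph_Component.connected H"
  shows "Digraph_Component.connected (G \<restriction> verts H)" "subgraph H (G \<restriction> verts H)"
proof -
  have wf: "wf_digraph (G \<restriction> verts H)"
    by (rule wellformed_induce_subgraph)
  show sub: "subgraph H (G \<restriction> verts H)"
    using assms(1) wf by (auto simp: subgraph_def compatible_def wf_digraph_def)
  then have "spanning H (G \<restriction> verts H)"
    by (simp add: spanning_def)
  then show "Digraph_Component.connected (G \<restriction> verts H)"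
    using wf_digraph.connected_spanning_imp_connected[OF wf] assms(2) by blast
qed

lemma (in sym_digraph) strongly_connected_induce_subgraph:
  assumes "subgraph H G" "Digraph_Component.connected H"
  shows "strongly_connected (G \<restriction> verts H)"
proof -
  have "induced_subgraph (G \<restriction> verts H) G"
    using assms(1) by (auto simp: subgraph_def)
  then have "symmetric (G \<restriction> verts H)"
    by (rule induced_graph_imp_symmetric[OF sym_arcs])
  then show ?thesis
    using wf_digraph.symmetric_connected_imp_strongly_connected[OF wellformed_induce_subgraph]
      connected_induce_subgraph(1)[OF assms] by blast
qed

lemma (in sym_digraph) components_eq_sccs: "components G = sccs"
proof -
  have sc: "Digraph_Component.connected H" if "strongly_connected H" "subgraph H G" for H
  proof -
    have "arcs_ends H \<subseteq> arcs_ends (with_proj (mk_symmetric H))"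
      by (auto simp: mk_symmetric_def arcs_ends_def arc_to_ends_def)
    moreover have "verts H \<subseteq> verts (with_proj (mk_symmetric H))"
      by (simp add: mk_symmetric_def)
    ultimately have "u \<rightarrow>\<^sup>*\<^bsub>with_proj (mk_symmetric H)\<^esub> v" if "u \<rightarrow>\<^sup>*\<^bsub>H\<^esub> v" for u v
      using that unfolding reachable_def by (metis rtrancl_on_mono)
    with \<open>strongly_connected H\<close> show ?thesis
      by (auto simp: Digraph_Component.connected_def strongly_connected_def mk_symmetric_def)
  qed
  have ind: "subgraph (G \<restriction> verts H) G" if "subgraph H G" for H
    using that wellformed_induce_subgraph[of "verts H"]
    by (auto simp: subgraph_def compatible_induce_subgraph compatible_def)
  have "max_subgraph Digraph_Component.connected H \<longleftrightarrow> max_subgraph strongly_connected H" for H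
  proof
    assume H: "max_subgraph Digraph_Component.connected H"
    then have sub: "subgraph H G" and con: "Digraph_Component.connected H"
      by (auto simp: max_subgraph_def)
    have "G \<restriction> verts H = H"
      using H connected_induce_subgraph[OF sub con] ind[OF sub] by (auto simp: max_subgraph_def)
    then have "strongly_connected H"
      using strongly_connected_induce_subgraph[OF sub con] by simp
    with H sc show "max_subgraph strongly_connected H"
      by (auto simp: max_subgraph_def)
  next
    assume H: "max_subgraph strongly_connected H"
    then have sub: "subgraph H G" and con: "Digraph_Component.connected H"
      using sc by (auto simp: max_subgraph_def)
    have "H' = H" if H': "subgraph H H'" "subgraph H' G" "Digraph_Component.connected H'" for H'
    proof -
      have 1: "subgraph H' (G \<restriction> verts H')"
        using connected_induce_subgraph(2) H'(2,3) .
      have "subgraph H (G \<restriction> verts H')"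
        using H'(1) 1 by (rule subgraph_trans)
      then have "G \<restriction> verts H' = H"
        using H ind[OF H'(2)] strongly_connected_induce_subgraph[OF H'(2,3)]
        by (auto simp: max_subgraph_def)
      with 1 H'(1) show ?thesis
        by (auto simp: subgraph_def compatible_def intro!: pre_digraph.equality)
    qed
    then show "max_subgraph Digraph_Component.connected H"
      using sub con by (auto simp: max_subgraph_def)
  qed
  then show ?thesis
    by (simp add: components_def sccs_altdef2)
qed

end

theory Submission
  imports Defs "HOL-Library.Countable"
begin

text \<open>
  The construction refines the graphs of Bauer, Broersma and Veldman. The gadget is a 4-cycle
  \<open>A B C D\<close> with an apex over each edge: \<open>P\<close> over \<open>AB\<close>, \<open>X\<close> over \<open>BC\<close>, \<open>Q\<close> over \<open>CD\<close>,
  \<open>Y\<close> over \<open>DA\<close>. It has no hamiltonian path from \<open>X\<close> to \<open>Y\<close>. Take \<open>m\<close> gadgets, make all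
  their vertices \<open>X\<close>, \<open>Y\<close> one clique, add \<open>n\<close> isolated leaves and join everything to a clique
  of \<open>l\<close> hubs.

  A hamiltonian cycle uses at most \<open>2 l\<close> edges at the hubs, so for \<open>m > 2 l\<close> it enters some gadget
  only through \<open>X\<close> and \<open>Y\<close>, which is impossible. A separating set must contain all hubs; if it
  splits off \<open>k\<close> components inside the gadgets, none of them containing an \<open>X\<close> or \<open>Y\<close>, then it has
  at least \<open>2 k\<close> gadget vertices, and \<open>k \<le> 2 m\<close>. So the toughness is the minimum of
  \<open>(l + 2 k) / (1 + n + k)\<close> over \<open>0 \<le> k \<le> 2 m\<close>, attained at \<open>k = 0\<close> if it is at most 2 and at
  \<open>k = 2 m\<close> otherwise; both ends are realised by actual separating sets.
\<close>

subsection \<open>Counting components\<close>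

lemma (in sym_digraph) reachable_iff_same_class:
  assumes "u \<in> verts G"
  shows "u \<rightarrow>\<^sup>* v \<longleftrightarrow> {w. u \<rightarrow>\<^sup>* w} = {w. v \<rightarrow>\<^sup>* w}"
proof
  assume "u \<rightarrow>\<^sup>* v"
  moreover then have "v \<rightarrow>\<^sup>* u"
    by (simp add: symmetric_reachable[OF sym_arcs])
  ultimately show "{w. u \<rightarrow>\<^sup>* w} = {w. v \<rightarrow>\<^sup>* w}"
    using reachable_trans by blast
next
  assume *: "{w. u \<rightarrow>\<^sup>* w} = {w. v \<rightarrow>\<^sup>* w}"
  have "u \<rightarrow>\<^sup>* u"
    using assms by (rule reachable_refl)
  with * have "v \<rightarrow>\<^sup>* u"
    by blast
  then show "u \<rightarrow>\<^sup>* v"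
    by (simp add: symmetric_reachable[OF sym_arcs])
qed

text \<open>In a symmetric digraph reachability is an equivalence relation on the vertices. Its
  classes are the vertex sets of the strongly connected components, which
  \<open>components_eq_sccs\<close> identifies with the components.\<close>

lemma (in sym_digraph) num_components_eq_card_classes:
  "num_components G = card ((\<lambda>v. {w. v \<rightarrow>\<^sup>* w}) ` verts G)"
proof -
  have sym: "v \<rightarrow>\<^sup>* u" if "u \<rightarrow>\<^sup>* v" for u v
    using that by (simp add: symmetric_reachable[OF sym_arcs])
  have "sccs_verts = (\<lambda>v. {w. v \<rightarrow>\<^sup>* w}) ` verts G"
  proof (intro equalityI subsetI)
    fix S assume S: "S \<in> sccs_verts"
    then obtain u where u: "u \<in> S"
      by (auto simp: sccs_verts_def)
    then have "u \<rightarrow>\<^sup>* u" "S = {w. u \<rightarrow>\<^sup>* w}"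
      using S sym by (auto simp: sccs_verts_def)
    then show "S \<in> (\<lambda>v. {w. v \<rightarrow>\<^sup>* w}) ` verts G"
      using reachable_in_verts(1) by blast
  next
    fix S assume "S \<in> (\<lambda>v. {w. v \<rightarrow>\<^sup>* w}) ` verts G"
    then show "S \<in> sccs_verts"
      using sym by (auto simp: sccs_verts_def intro: reachable_trans)
  qed
  then show ?thesis
    by (simp add: num_components_def components_eq_sccs flip: card_sccs_verts)
qed

text \<open>Tool for lower bounds: a label that no arc changes is constant on reachability classes,
  so it factors through them.\<close>

lemma (in sym_digraph) card_image_le_num_components:
  assumes "finite (verts G)" and arc: "\<And>u v. (u, v) \<in> arcs_ends G \<Longrightarrow> f u = f v"
  shows "card (f ` verts G) \<le> num_components G"
proof -
  have eq: "f u = f v" if "u \<rightarrow>\<^sup>* v" for u v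
    using that by (induction rule: reachable_induct) (auto dest: arc)
  have "f ` {w. v \<rightarrow>\<^sup>* w} = {f v}" if "v \<in> verts G" for v
    using that eq by (auto intro: rev_image_eqI)
  then have "f ` verts G = (\<lambda>K. the_elem (f ` K)) ` (\<lambda>v. {w. v \<rightarrow>\<^sup>* w}) ` verts G"
    by (auto simp: image_image)
  then show ?thesis
    unfolding num_components_eq_card_classes
    using card_image_le[OF finite_imageI[OF assms(1)]] by metis
qed

text \<open>Tool for upper bounds: if equal labels imply reachability, a representative of each
  label, picked by \<open>inv_into\<close>, determines every class.\<close>

lemma (in sym_digraph) num_components_le_card_image:
  assumes "finite (verts G)"
    and "\<And>u v. \<lbrakk>u \<in> verts G; v \<in> verts G; f u = f v\<rbrakk> \<Longrightarrow> u \<rightarrow>\<^sup>* v"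
  shows "num_components G \<le> card (f ` verts G)"
proof -
  let ?c = "\<lambda>v. {w. v \<rightarrow>\<^sup>* w}"
  have "?c (inv_into (verts G) f (f v)) = ?c v" if "v \<in> verts G" for v
    using that assms(2) inv_into_into[of "f v" f "verts G"] f_inv_into_f[of "f v" f "verts G"]
      reachable_iff_same_class by blast
  then have "?c ` verts G = (\<lambda>k. ?c (inv_into (verts G) f k)) ` f ` verts G"
    by (auto simp: image_image)
  then show ?thesis
    unfolding num_components_eq_card_classes
    using card_image_le[OF finite_imageI[OF assms(1)]] by metis
qed

subsection \<open>Hamiltonian cycles as connected 2-factors\<close>

text \<open>
  \<open>N v\<close> is the set of the two neighbours of \<open>v\<close> on the cycle. The second conjunct excludes
  proper subcycles.
\<close>
definition connected_2_factor :: "'a set \<Rightarrow> ('a \<Rightarrow> 'a \<Rightarrow> bool) \<Rightarrow> ('a \<Rightarrow> 'a set) \<Rightarrow> bool" where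
  "connected_2_factor V E N \<longleftrightarrow>
     (\<forall>v \<in> V. N v \<subseteq> V \<and> card (N v) = 2 \<and> (\<forall>u \<in> N v. E v u \<and> v \<in> N u)) \<and>
     (\<forall>A \<subseteq> V. A \<noteq> {} \<longrightarrow> (\<forall>v \<in> A. N v \<subseteq> A) \<longrightarrow> A = V)"

lemma (in pre_digraph) cas_nth:
  assumes "cas u p v" "Suc i < length p"
  shows "head G (p ! i) = tail G (p ! Suc i)"
  using assms
proof (induction p arbitrary: u i)
  case (Cons e p)
  then show ?case
    by (cases i; cases p) auto
qed simp

lemma (in pair_graph) hamiltonian_imp_connected_2_factor:
  assumes "hamiltonian (with_proj G)"
  obtains N where "connected_2_factor (pverts G) (\<lambda>u v. (u, v) \<in> parcs G) N"
proof -
  obtain p u where p: "awalk u p u" "distinct (tl (awalk_verts u p))" "3 \<le> length p"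
    and set: "fst ` set p = pverts G"
    using assms by (auto simp: hamiltonian_def cycle_def)
  define n where "n = length p"
  \<comment> \<open>Indices modulo \<open>n\<close> turn the cycle into a periodic sequence on all
    naturals; the predecessor of index \<open>j\<close> becomes \<open>j + n - 1\<close>.\<close>
  define x where "x i = fst (p ! (i mod n))" for i
  have n: "3 \<le> n"
    using p n_def by simp
  have cas: "cas u p u" and arcs: "set p \<subseteq> parcs G"
    using p by (auto simp: awalk_def)
  have less: "i mod n < n" for i
    using n by simp
  have snd: "snd (p ! (i mod n)) = x (Suc i)" for i
  proof (cases "Suc (i mod n) < n")
    case True
    then show ?thesis
      using cas_nth[OF cas, of "i mod n"] by (simp add: x_def n_def mod_Suc)
  next
    case False
    then have "Suc (i mod n) = n"
      using less[of i] by simp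
    moreover have "p \<noteq> []"
      using n by (auto simp: n_def)
    moreover then have "p ! (n - 1) = last p" "p ! 0 = hd p"
      by (simp_all add: n_def last_conv_nth hd_conv_nth)
    moreover have "fst (hd p) = u" "snd (last p) = u"
      using cas \<open>p \<noteq> []\<close> awlast_if_cas[OF cas] cas_simp[of p u u]
      by (auto simp: awalk_verts_conv)
    moreover have "i mod n = n - 1" "Suc i mod n = 0"
      using \<open>Suc (i mod n) = n\<close> by (simp_all add: mod_Suc)
    ultimately show ?thesis
      by (simp add: x_def)
  qed
  have per: "x (i + n) = x i" for i
    by (simp add: x_def)
  have "distinct (map snd p)"
    using p(2) n unfolding awalk_verts_conv'[OF cas] by (cases "p = []") (simp_all add: n_def)
  \<comment> \<open>The cycle condition makes the heads of the arcs distinct, hence the shift by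
    \<open>Suc\<close>.\<close>
  then have inj: "x (Suc i) = x (Suc j) \<longleftrightarrow> i mod n = j mod n" for i j
    using less nth_eq_iff_index_eq[of "map snd p" "i mod n" "j mod n"]
    unfolding snd[symmetric] by (simp add: n_def)
  have arc: "(x i, x (Suc i)) \<in> parcs G" for i
  proof -
    have "p ! (i mod n) \<in> set p"
      using less by (simp add: n_def)
    then show ?thesis
      using arcs by (metis snd x_def prod.collapse subsetD)
  qed
  have range: "range (\<lambda>i. x (Suc i)) = pverts G"
  proof (intro equalityI subsetI)
    fix v assume "v \<in> pverts G"
    then obtain i where "i < n" "v = fst (p ! i)"
      by (auto simp: n_def in_set_conv_nth simp flip: set)
    then have "v = x (Suc (i + n - 1))"
      using n per by (simp add: x_def)
    then show "v \<in> range (\<lambda>i. x (Suc i))"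
      by blast
  qed (use arc in \<open>auto dest: in_arcsD2\<close>)
  define N where "N v = {w. \<exists>i. v = x i \<and> w = x (Suc i) \<or> v = x (Suc i) \<and> w = x i}" for v
  have N: "N (x (Suc i)) = {x i, x (Suc (Suc i))}" for i
  proof -
    have *: "x i = x j" "x (Suc (Suc i)) = x (Suc (Suc j))" if "x (Suc i) = x (Suc j)" for j
      using that unfolding inj by (simp_all add: x_def mod_Suc)
    have "w \<in> {x i, x (Suc (Suc i))}" if "w \<in> N (x (Suc i))" for w
    proof -
      obtain j where "x (Suc i) = x j \<and> w = x (Suc j) \<or> x (Suc i) = x (Suc j) \<and> w = x j"
        using \<open>w \<in> N (x (Suc i))\<close> by (auto simp: N_def)
      moreover have "x j = x (Suc (j + n - 1))" "x (Suc j) = x (Suc (Suc (j + n - 1)))"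
        using n per[of j] per[of "Suc j"] by simp_all
      ultimately show ?thesis
        using *[of j] *[of "j + n - 1"] by auto
    qed
    then show ?thesis
      by (auto simp: N_def)
  qed
  \<comment> \<open>The two neighbours differ because \<open>3 <= n\<close>; the closed walk
    \<open>a, b, a\<close> would give only one.\<close>
  have ne: "x i \<noteq> x (Suc (Suc i))" for i
  proof
    assume "x i = x (Suc (Suc i))"
    moreover have "x i = x (Suc (i + n - 1))"
      using n per[of i] by simp
    ultimately have "(i + n - 1) mod n = Suc i mod n"
      using inj by simp
    then have "n dvd n - 2"
      using n by (subst (asm) mod_eq_dvd_iff_nat) auto
    then show False
      using n by (auto dest: dvd_imp_le)
  qed
  have "connected_2_factor (pverts G) (\<lambda>u v. (u, v) \<in> parcs G) N"
    unfolding connected_2_factor_def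
  proof (intro conjI ballI allI impI)
    fix v assume "v \<in> pverts G"
    then obtain i where i: "v = x (Suc i)"
      using range by blast
    show "N v \<subseteq> pverts G" "card (N v) = 2"
      using ne[of i] arc[of i] arc[of "Suc i"] by (auto simp: i N dest: in_arcsD1 in_arcsD2)
    fix w assume w: "w \<in> N v"
    then show "v \<in> N w"
      by (auto simp: N_def)
    have "(v, w) \<in> parcs G \<or> (w, v) \<in> parcs G"
      using w arc[of i] arc[of "Suc i"] by (auto simp: i N)
    then show "(v, w) \<in> parcs G"
      using arcs_symmetric by blast
  next
    fix A assume A: "A \<subseteq> pverts G" "A \<noteq> {}" "\<forall>v \<in> A. N v \<subseteq> A"
    then obtain v where "v \<in> A" "v \<in> pverts G"
      by blast
    then obtain i where i: "x (Suc i) \<in> A"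
      using range by (metis imageE)
    have reached: "x (Suc (i + k)) \<in> A" for k
    proof (induction k)
      case (Suc k)
      then have "N (x (Suc (i + k))) \<subseteq> A"
        using A(3) by blast
      then show ?case
        by (simp add: N)
    qed (use i in simp)
    \<comment> \<open>Adding a multiple of \<open>n\<close> keeps the subtraction from truncating:
      every vertex is some number of forward steps away from \<open>x (Suc i)\<close>.\<close>
    have shift: "x (Suc j) = x (Suc (i + (j + i * n - i)))" for j
    proof -
      have "i \<le> j + i * n"
        using n by (simp add: trans_le_add2)
      then show ?thesis
        by (simp add: inj)
    qed
    have "x (Suc j) \<in> A" for j
      by (subst shift) (rule reached)
    then have "pverts G \<subseteq> A"
      unfolding range[symmetric] by (rule image_subsetI)
    with A(1) show "A = pverts G"
      by (rule subset_antisym)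
  qed
  then show ?thesis
    by (rule that)
qed

subsection \<open>Graphs on natural numbers\<close>

text \<open>The theorem asks for vertices of type \<open>nat\<close>, while the construction is
  clearer on a datatype; the injection \<open>to_nat\<close> transports it.\<close>

definition nat_graph :: "'a::countable set \<Rightarrow> ('a \<Rightarrow> 'a \<Rightarrow> bool) \<Rightarrow> nat pair_pre_digraph" where
  "nat_graph V E = \<lparr>pverts = to_nat ` V, parcs = {(to_nat u, to_nat v) | u v. u \<in> V \<and> v \<in> V \<and> E u v}\<rparr>"

lemma pair_graph_nat_graph:
  assumes "finite V" "symp E" "irreflp E"
  shows "pair_graph (nat_graph V E)"
proof
  have "parcs (nat_graph V E) \<subseteq> (to_nat ` V) \<times> (to_nat ` V)"
    by (auto simp: nat_graph_def)
  then show "finite (parcs (nat_graph V E))"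
    by (rule finite_subset) (use assms(1) in simp)
  show "symmetric (with_proj (nat_graph V E))"
    unfolding symmetric_def
  proof (rule symI)
    fix u v assume "(u, v) \<in> arcs_ends (with_proj (nat_graph V E))"
    then show "(v, u) \<in> arcs_ends (with_proj (nat_graph V E))"
      using sympD[OF assms(2)] by (auto simp: nat_graph_def)
  qed
qed (use assms(1) irreflpD[OF assms(3)] in \<open>auto simp: nat_graph_def\<close>)

lemma arcs_ends_delete_vertices:
  "(u, v) \<in> arcs_ends (delete_vertices (with_proj G) S) \<longleftrightarrow>
     (u, v) \<in> parcs G \<and> u \<in> pverts G - S \<and> v \<in> pverts G - S"
  by (force simp: arcs_ends_def arc_to_ends_def delete_vertices_def)

lemma (in sym_digraph) sym_digraph_delete_vertices: "sym_digraph (delete_vertices G S)"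
proof -
  interpret H: wf_digraph "delete_vertices G S"
    unfolding delete_vertices_def by (rule wellformed_induce_subgraph)
  have "induced_subgraph (delete_vertices G S) G"
    by (auto simp: delete_vertices_def)
  then show ?thesis
    using induced_graph_imp_symmetric[OF sym_arcs] by unfold_locales
qed

context
  fixes V :: "'a::countable set" and E :: "'a \<Rightarrow> 'a \<Rightarrow> bool" and G
  assumes fin: "finite V" and E_sym: "symp E" and E_irrefl: "irreflp E"
  defines "G \<equiv> nat_graph V E"
begin

lemma card_image_le_num_components_nat_graph:
  assumes "\<And>u v. \<lbrakk>u \<in> V - S; v \<in> V - S; E u v\<rbrakk> \<Longrightarrow> f u = f v"
  shows "card (f ` (V - S)) \<le> num_components (delete_vertices (with_proj G) (to_nat ` S))"
    (is "_ \<le> num_components ?H")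
proof -
  interpret pair_graph G
    unfolding G_def using fin E_sym E_irrefl by (rule pair_graph_nat_graph)
  interpret H: sym_digraph ?H
    by (rule sym_digraph_delete_vertices)
  have verts: "verts ?H = to_nat ` (V - S)"
    by (auto simp: delete_vertices_def G_def nat_graph_def)
  have "card ((f \<circ> from_nat) ` verts ?H) \<le> num_components ?H"
  proof (rule H.card_image_le_num_components)
    fix u v assume "(u, v) \<in> arcs_ends ?H"
    then show "(f \<circ> from_nat) u = (f \<circ> from_nat) v"
      unfolding arcs_ends_delete_vertices using assms by (auto simp: G_def nat_graph_def inj_image_mem_iff)
  qed (use fin in \<open>simp add: verts\<close>)
  then show ?thesis
    by (simp add: verts image_image)
qed

lemma num_components_nat_graph_le_card_image:
  assumes "\<And>u v. \<lbrakk>u \<in> V - S; v \<in> V - S; f u = f v\<rbrakk> \<Longrightarrow>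
    (\<lambda>u v. u \<in> V - S \<and> v \<in> V - S \<and> E u v)\<^sup>*\<^sup>* u v"
  shows "num_components (delete_vertices (with_proj G) (to_nat ` S)) \<le> card (f ` (V - S))"
    (is "num_components ?H \<le> _")
proof -
  interpret pair_graph G
    unfolding G_def using fin E_sym E_irrefl by (rule pair_graph_nat_graph)
  interpret H: sym_digraph ?H
    by (rule sym_digraph_delete_vertices)
  have verts: "verts ?H = to_nat ` (V - S)"
    by (auto simp: delete_vertices_def G_def nat_graph_def)
  have reach: "to_nat u \<rightarrow>\<^sup>*\<^bsub>?H\<^esub> to_nat v"
    if "(\<lambda>u v. u \<in> V - S \<and> v \<in> V - S \<and> E u v)\<^sup>*\<^sup>* u v" "u \<in> V - S" for u v
    using that
  proof (induction rule: rtranclp_induct)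
    case base
    then show ?case
      by (intro H.reachable_refl) (auto simp: verts)
  next
    case (step v w)
    moreover have "(to_nat v, to_nat w) \<in> arcs_ends ?H"
      using step(2) by (auto simp: arcs_ends_delete_vertices G_def nat_graph_def)
    ultimately show ?case
      using H.reachable_adj_trans by blast
  qed
  have "num_components ?H \<le> card ((f \<circ> from_nat) ` verts ?H)"
    using assms fin reach by (intro H.num_components_le_card_image) (auto simp: verts)
  then show ?thesis
    by (simp add: verts image_image)
qed

lemma not_hamiltonian_nat_graph:
  assumes "\<And>N. \<not> connected_2_factor V E N"
  shows "\<not> hamiltonian (with_proj G)"
proof
  interpret pair_graph G
    unfolding G_def using fin E_sym E_irrefl by (rule pair_graph_nat_graph)
  have V: "pverts G = to_nat ` V"
    by (simp add: G_def nat_graph_def)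
  assume "hamiltonian (with_proj G)"
  then obtain N where N: "connected_2_factor (pverts G) (\<lambda>u v. (u, v) \<in> parcs G) N"
    by (rule hamiltonian_imp_connected_2_factor)
  \<comment> \<open>For \<open>v\<close> in \<open>V\<close> the set \<open>N (to_nat v)\<close>
    lies in the image of \<open>V\<close>, where \<open>from_nat\<close> is undone by
    \<open>to_nat\<close>.\<close>
  define M :: "'a \<Rightarrow> 'a set" where "M v = from_nat ` N (to_nat v)" for v
  have M: "to_nat ` M v = N (to_nat v)" if "v \<in> V" for v
  proof -
    have "N (to_nat v) \<subseteq> range (to_nat :: 'a \<Rightarrow> nat)"
      using N that by (fastforce simp: connected_2_factor_def V)
    then show ?thesis
      by (force simp: M_def)
  qed
  have inj: "to_nat ` B \<subseteq> to_nat ` C \<longleftrightarrow> B \<subseteq> C" for B C :: "'a set"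
    by (simp add: inj_image_subset_iff)
  have "connected_2_factor V E M"
    unfolding connected_2_factor_def
  proof (intro conjI ballI allI impI)
    fix v assume v: "v \<in> V"
    then have Nv: "N (to_nat v) \<subseteq> to_nat ` V" "card (N (to_nat v)) = 2"
      "\<forall>u \<in> N (to_nat v). (to_nat v, u) \<in> parcs G \<and> to_nat v \<in> N u"
      using N by (auto simp: connected_2_factor_def V)
    show "M v \<subseteq> V"
      using Nv(1) M[OF v] inj by metis
    show "card (M v) = 2"
      using Nv(2) M[OF v] card_image[of to_nat "M v"] by simp
    fix u assume u: "u \<in> M v"
    then have "to_nat u \<in> N (to_nat v)"
      using M[OF v] by blast
    with Nv(3) have *: "(to_nat v, to_nat u) \<in> parcs G" "to_nat v \<in> N (to_nat u)"
      by auto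
    show "E v u"
      using *(1) by (auto simp: G_def nat_graph_def)
    show "v \<in> M u"
      using *(2) unfolding M_def by (force intro: rev_image_eqI)
  next
    fix A assume A: "A \<subseteq> V" "A \<noteq> {}" "\<forall>v \<in> A. M v \<subseteq> A"
    then have "\<forall>v \<in> to_nat ` A. N v \<subseteq> to_nat ` A"
      using M by (metis (no_types, lifting) image_iff image_mono subsetD)
    then have "to_nat ` A = to_nat ` V"
      using N A(1,2) by (simp add: connected_2_factor_def V image_mono)
    then show "A = V"
      by (simp add: inj_image_eq_iff)
  qed
  with assms show False
    by blast
qed

end

subsection \<open>The gadget\<close>

datatype role = A | B | C | D | P | Q | X | Y

fun gadget_adj :: "role \<Rightarrow> role \<Rightarrow> bool" where
  "gadget_adj A s \<longleftrightarrow> s \<in> {B, D, P, Y}"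
| "gadget_adj B s \<longleftrightarrow> s \<in> {A, C, P, X}"
| "gadget_adj C s \<longleftrightarrow> s \<in> {B, D, Q, X}"
| "gadget_adj D s \<longleftrightarrow> s \<in> {A, C, Q, Y}"
| "gadget_adj P s \<longleftrightarrow> s \<in> {A, B}"
| "gadget_adj Q s \<longleftrightarrow> s \<in> {C, D}"
| "gadget_adj X s \<longleftrightarrow> s \<in> {B, C}"
| "gadget_adj Y s \<longleftrightarrow> s \<in> {A, D}"

lemma UNIV_role: "UNIV = {A, B, C, D, P, Q, X, Y}"
  using role.exhaust by blast

instance role :: finite
  by standard (simp add: UNIV_role)

lemma ex_role: "(\<exists>r. R r) \<longleftrightarrow> R A \<or> R B \<or> R C \<or> R D \<or> R P \<or> R Q \<or> R X \<or> R Y"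
  by (metis role.exhaust)

text \<open>Writes a cardinality as a sum of truth values, so that a bound on it becomes a finite
  case check.\<close>

lemma card_role_set: "card T = of_bool (A \<in> T) + of_bool (B \<in> T) + of_bool (C \<in> T) + of_bool (D \<in> T)
    + of_bool (P \<in> T) + of_bool (Q \<in> T) + of_bool (X \<in> T) + of_bool (Y \<in> T)"
proof -
  have "card T = (\<Sum>r\<in>UNIV. of_bool (r \<in> T))"
    by simp
  then show ?thesis
    unfolding UNIV_role by simp
qed

instance role :: countable
  by countable_datatype

datatype vertex = Hub nat | Leaf nat | Gad nat role

instance vertex :: countable
  by countable_datatype

fun adj :: "vertex \<Rightarrow> vertex \<Rightarrow> bool" where
  "adj (Hub i) v \<longleftrightarrow> v \<noteq> Hub i"
| "adj (Leaf i) v \<longleftrightarrow> (\<exists>j. v = Hub j)"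
| "adj (Gad i r) (Hub j) \<longleftrightarrow> True"
| "adj (Gad i r) (Leaf j) \<longleftrightarrow> False"
| "adj (Gad i r) (Gad j s) \<longleftrightarrow>
     i = j \<and> gadget_adj r s \<or> r \<in> {X, Y} \<and> s \<in> {X, Y} \<and> Gad i r \<noteq> Gad j s"

definition vertices :: "nat \<Rightarrow> nat \<Rightarrow> nat \<Rightarrow> vertex set" where
  "vertices l n m = Hub ` {..<l} \<union> Leaf ` {..<n} \<union> {Gad i r | i r. i < m}"

lemma gadget_adj_sym: "gadget_adj r s \<Longrightarrow> gadget_adj s r"
  by (cases r; cases s) auto

lemma adj_sym: "adj u v \<Longrightarrow> adj v u"
  by (cases u; cases v) (auto dest: gadget_adj_sym)

lemma symp_adj: "symp adj"
  using adj_sym by (rule sympI)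

lemma irreflp_adj: "irreflp adj"
proof (rule irreflpI)
  fix v
  have "\<not> gadget_adj r r" for r
    by (cases r) auto
  then show "\<not> adj v v"
    by (cases v) auto
qed

lemma finite_vertices: "finite (vertices l n m)"
proof -
  have "{Gad i r | i r. i < m} = case_prod Gad ` ({..<m} \<times> UNIV)"
    by auto
  then show ?thesis
    by (simp add: vertices_def)
qed

text \<open>In a gadget that the cycle does not enter from a hub, \<open>P\<close> and
  \<open>Q\<close> force the paths \<open>A P B\<close> and \<open>C Q D\<close>. These can only be
  joined to each other, by \<open>B C\<close> or through \<open>X\<close> and by \<open>A D\<close>
  or through \<open>Y\<close>, so the cycle closes up inside the gadget.\<close>

lemma no_connected_2_factor:
  assumes "2 * l < m" "0 < n"
  shows "\<not> connected_2_factor (vertices l n m) adj N"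
proof
  let ?V = "vertices l n m"
  assume factor: "connected_2_factor ?V adj N"
  have card: "card (N v) = 2" and sub: "N v \<subseteq> ?V" if "v \<in> ?V" for v
    using factor that by (auto simp: connected_2_factor_def)
  have adj: "adj v u" and sym: "v \<in> N u" if "u \<in> N v" "v \<in> ?V" for u v
    using factor that by (auto simp: connected_2_factor_def)
  have closed: "K = ?V" if "K \<subseteq> ?V" "K \<noteq> {}" "\<And>v. v \<in> K \<Longrightarrow> N v \<subseteq> K" for K
    using factor that by (auto simp: connected_2_factor_def)
  \<comment> \<open>the gadgets that the cycle reaches directly from a hub\<close>
  define hit where "hit = {i. \<exists>j<l. \<exists>r. Gad i r \<in> N (Hub j)}"
  have "finite hit" "card hit < m"
  proof -
    \<comment> \<open>Hubs and leaves get the arbitrary value 0; this can only enlarge the union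
      that covers \<open>hit\<close>.\<close>
    let ?I = "\<lambda>j. (\<lambda>v. case v of Gad i r \<Rightarrow> i | _ \<Rightarrow> 0) ` N (Hub j)"
    have two: "card (N (Hub j)) = 2" if "j < l" for j
      using that by (intro card) (simp add: vertices_def)
    then have fin: "finite (N (Hub j))" if "j < l" for j
      using that by (intro card_ge_0_finite) simp
    have le: "card (?I j) \<le> 2" if "j < l" for j
      using card_image_le[OF fin[OF that]] two[OF that] by metis
    have hit: "hit \<subseteq> (\<Union>j<l. ?I j)"
      by (force simp: hit_def)
    have U: "finite (\<Union>j<l. ?I j)"
      using fin by simp
    show "finite hit"
      using hit U by (rule finite_subset)
    have "card hit \<le> card (\<Union>j<l. ?I j)"
      using U hit by (rule card_mono)
    also have "\<dots> \<le> (\<Sum>j<l. card (?I j))"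
      by (intro card_UN_le) simp
    also have "\<dots> \<le> (\<Sum>j<l. 2)"
      using le by (intro sum_mono) simp
    finally show "card hit < m"
      using assms(1) by simp
  qed
  then have "\<not> {..<m} \<subseteq> hit"
    using card_mono[of hit "{..<m}"] by auto
  then obtain i where i: "i < m" "i \<notin> hit"
    by auto
  define g where "g = Gad i"
  have gV: "g r \<in> ?V" for r
    using i(1) by (auto simp: g_def vertices_def)
  have g_eq: "g r = g s \<longleftrightarrow> r = s" for r s
    by (simp add: g_def)
  \<comment> \<open>Apart from edges to hubs, which the choice of \<open>i\<close> excludes, only
    \<open>X\<close> and \<open>Y\<close> have edges leaving the gadget.\<close>
  have inner: "N (g r) \<subseteq> g ` {s. gadget_adj r s}" if "r \<notin> {X, Y}" for r
  proof
    fix v assume v: "v \<in> N (g r)"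
    then have "adj (g r) v" "g r \<in> N v" "v \<in> ?V"
      using adj sym sub gV by blast+
    moreover have "v \<noteq> Hub j" for j
      using i(2) \<open>g r \<in> N v\<close> \<open>v \<in> ?V\<close> by (auto simp: hit_def g_def vertices_def)
    ultimately show "v \<in> g ` {s. gadget_adj r s}"
      using that by (cases v) (auto simp: g_def)
  qed
  have gsym: "g s \<in> N (g r) \<longleftrightarrow> g r \<in> N (g s)" for r s
    using sym gV by blast
  have NP: "N (g P) = {g A, g B}" and NQ: "N (g Q) = {g C, g D}"
    using inner[of P] inner[of Q] card[OF gV, of P] card[OF gV, of Q]
    by (auto simp: card_2_iff g_eq)
  \<comment> \<open>Such a \<open>K\<close> would have to be everything, but it misses
    \<open>Leaf 0\<close>, which exists because \<open>0 < n\<close>.\<close>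
  have improper: False if "K \<subseteq> range g" "K \<noteq> {}" "\<And>v. v \<in> K \<Longrightarrow> N v \<subseteq> K" for K
  proof -
    have "K = ?V"
      using that gV by (intro closed) auto
    moreover have "Leaf 0 \<in> ?V"
      using assms(2) by (simp add: vertices_def)
    ultimately show False
      using that(1) by (auto simp: g_def)
  qed
  have pair: "N (g r) = {g s, g t}" if "g s \<in> N (g r)" "g t \<in> N (g r)" "s \<noteq> t" for r s t
    using that card[OF gV, of r] by (auto simp: card_2_iff g_eq)
  have branch: "\<exists>t. N (g r) = {g s, g t} \<and> t \<noteq> s \<and> gadget_adj r t"
    if "g s \<in> N (g r)" "r \<notin> {X, Y}" for r s
  proof -
    obtain v w where vw: "N (g r) = {v, w}" "v \<noteq> w"
      using card[OF gV, of r] by (auto simp: card_2_iff)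
    have "v = g s \<or> w = g s"
      using that(1) unfolding vw(1) by blast
    then obtain v where v: "N (g r) = {g s, v}" "v \<noteq> g s"
      using vw by (metis insert_commute)
    then have "v \<in> g ` {t. gadget_adj r t}"
      using inner[OF that(2)] by auto
    with v show ?thesis
      by auto
  qed
  have NA: "N (g A) = {g P, g D} \<or> N (g A) = {g P, g Y}"
  proof -
    have PA: "g P \<in> N (g A)" "g P \<in> N (g B)"
      using NP gsym by blast+
    then obtain t where t: "N (g A) = {g P, g t}" "t \<noteq> P" "gadget_adj A t"
      using branch[of P A] by auto
    \<comment> \<open>The edge \<open>A B\<close> would close the triangle \<open>A B P\<close>, a
      proper subcycle.\<close>
    moreover have False if "t = B"
    proof -
      have "g A \<in> N (g B)"
        using t that gsym by blast
      then have "N (g B) = {g P, g A}"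
        using PA pair by blast
      then show False
        using t that NP by (intro improper[of "{g A, g B, g P}"]) auto
    qed
    ultimately show ?thesis
      by auto
  qed
  have NB: "N (g B) = {g P, g C} \<or> N (g B) = {g P, g X}"
  proof -
    have "g P \<in> N (g B)"
      using NP gsym by blast
    then obtain t where "N (g B) = {g P, g t}" "t \<noteq> P" "gadget_adj B t"
      using branch[of P B] by auto
    moreover have "g B \<notin> N (g A)"
      using NA by (auto simp: g_eq)
    then have "g A \<notin> N (g B)"
      using gsym by blast
    ultimately show ?thesis
      by auto
  qed
  \<comment> \<open>\<open>C\<close> and \<open>D\<close> are treated like \<open>A\<close> and
    \<open>B\<close>, by the half-turn that swaps \<open>P\<close> with \<open>Q\<close> and
    \<open>X\<close> with \<open>Y\<close>.\<close>
  have NC: "N (g C) = {g Q, g B} \<or> N (g C) = {g Q, g X}"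
  proof -
    have PC: "g Q \<in> N (g C)" "g Q \<in> N (g D)"
      using NQ gsym by blast+
    then obtain t where t: "N (g C) = {g Q, g t}" "t \<noteq> Q" "gadget_adj C t"
      using branch[of Q C] by auto
    moreover have False if "t = D"
    proof -
      have "g C \<in> N (g D)"
        using t that gsym by blast
      then have "N (g D) = {g Q, g C}"
        using PC pair by blast
      then show False
        using t that NQ by (intro improper[of "{g C, g D, g Q}"]) auto
    qed
    ultimately show ?thesis
      by auto
  qed
  have ND: "N (g D) = {g Q, g A} \<or> N (g D) = {g Q, g Y}"
  proof -
    have "g Q \<in> N (g D)"
      using NQ gsym by blast
    then obtain t where "N (g D) = {g Q, g t}" "t \<noteq> Q" "gadget_adj D t"
      using branch[of Q D] by auto
    moreover have "g D \<notin> N (g C)"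
      using NC by (auto simp: g_eq)
    then have "g C \<notin> N (g D)"
      using gsym by blast
    ultimately show ?thesis
      by auto
  qed
  \<comment> \<open>If \<open>B\<close> goes on to \<open>X\<close>, then \<open>C\<close> cannot go
    on to \<open>B\<close> and must go to \<open>X\<close> too. This uses up both cycle edges at
    \<open>X\<close>, so the cycle cannot leave the gadget there.\<close>
  have BC: "N (g B) = {g P, g C} \<and> N (g C) = {g Q, g B} \<or>
      N (g B) = {g P, g X} \<and> N (g C) = {g Q, g X} \<and> N (g X) = {g B, g C}"
    using NB
  proof
    assume B: "N (g B) = {g P, g C}"
    then have "g B \<in> N (g C)"
      using gsym by blast
    then have "N (g C) = {g Q, g B}"
      using NC by (auto simp: g_eq)
    with B show ?thesis
      by blast
  next
    assume B: "N (g B) = {g P, g X}"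
    then have "g C \<notin> N (g B)"
      by (simp add: g_eq)
    then have "g B \<notin> N (g C)"
      using gsym by blast
    then have C: "N (g C) = {g Q, g X}"
      using NC by auto
    have "g B \<in> N (g X)" "g C \<in> N (g X)"
      using B C gsym by blast+
    then have "N (g X) = {g B, g C}"
      by (rule pair) simp
    with B C show ?thesis
      by blast
  qed
  have AD: "N (g A) = {g P, g D} \<and> N (g D) = {g Q, g A} \<or>
      N (g A) = {g P, g Y} \<and> N (g D) = {g Q, g Y} \<and> N (g Y) = {g A, g D}"
    using NA
  proof
    assume B: "N (g A) = {g P, g D}"
    then have "g A \<in> N (g D)"
      using gsym by blast
    then have "N (g D) = {g Q, g A}"
      using ND by (auto simp: g_eq)
    with B show ?thesis
      by blast
  next
    assume B: "N (g A) = {g P, g Y}"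
    then have "g D \<notin> N (g A)"
      by (simp add: g_eq)
    then have "g A \<notin> N (g D)"
      using gsym by blast
    then have C: "N (g D) = {g Q, g Y}"
      using ND by auto
    have "g A \<in> N (g Y)" "g D \<in> N (g Y)"
      using B C gsym by blast+
    then have "N (g Y) = {g A, g D}"
      by (rule pair) simp
    with B C show ?thesis
      by blast
  qed
  \<comment> \<open>The cycle closes up inside the gadget, passing through \<open>X\<close>, \<open>Y\<close>, both or neither.\<close>
  define K where "K = g ` ({A, B, C, D, P, Q} \<union> {r. r = X \<and> g X \<in> N (g B) \<or> r = Y \<and> g Y \<in> N (g A)})"
  show False
  proof (rule improper)
    show "K \<subseteq> range g" "K \<noteq> {}"
      by (auto simp: K_def)
    show "N v \<subseteq> K" if v: "v \<in> K" for v
      using BC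
    proof (elim disjE conjE)
      assume "N (g B) = {g P, g C}" "N (g C) = {g Q, g B}"
      then show ?thesis
        using AD v NP NQ by (elim disjE conjE) (auto simp: K_def g_eq)
    next
      assume "N (g B) = {g P, g X}" "N (g C) = {g Q, g X}" "N (g X) = {g B, g C}"
      then show ?thesis
        using AD v NP NQ by (elim disjE conjE) (auto simp: K_def g_eq)
    qed
  qed
qed

section \<open>Components that a deletion leaves inside a gadget\<close>

definition avoids :: "role set \<Rightarrow> role \<Rightarrow> role \<Rightarrow> bool" where
  "avoids T r s \<longleftrightarrow> r \<notin> T \<and> s \<notin> T"

text \<open>For adjacent roles, \<open>avoids\<close> says that their edge survives. A triangle is
  anchored if it keeps an edge to the clique of all \<open>X\<close> and \<open>Y\<close>; left
  means \<open>A B P\<close>, right means \<open>C D Q\<close>.\<close>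

definition left_anchored :: "role set \<Rightarrow> bool" where
  "left_anchored T \<longleftrightarrow> avoids T A Y \<or> avoids T B X"

definition right_anchored :: "role set \<Rightarrow> bool" where
  "right_anchored T \<longleftrightarrow> avoids T D Y \<or> avoids T C X"

definition linked :: "role set \<Rightarrow> bool" where
  "linked T \<longleftrightarrow> avoids T A D \<or> avoids T B C"

text \<open>
  After deleting \<open>T\<close>, each of the triangles \<open>ABP\<close> and \<open>CDQ\<close> is empty or connected. The label \<open>X\<close>
  stands for the component of the clique of all \<open>X\<close> and \<open>Y\<close>; a gadget with both triangles in one
  other component uses the label \<open>A\<close> for both. Labels of deleted vertices are meaningless.
\<close>
definition component_label :: "role set \<Rightarrow> role \<Rightarrow> role" where
  "component_label T r =
     (if r \<in> {X, Y} then X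
      else if r \<in> {A, B, P} then
        (if left_anchored T \<or> linked T \<and> right_anchored T then X else A)
      else (if right_anchored T \<or> linked T \<and> left_anchored T then X
        else if linked T then A else C))"

definition free_labels :: "role set \<Rightarrow> role set" where
  "free_labels T = component_label T ` (- T) - {X}"

lemma free_labels_subset: "free_labels T \<subseteq> {A, C}"
  by (auto simp: free_labels_def component_label_def)

text \<open>A free label leaves one triangle unanchored; its edges to \<open>X\<close> and
  \<open>Y\<close> are disjoint, so two vertices are deleted. With two free labels no anchoring or
  linking edge survives. These edges form the disjoint triangles \<open>A D Y\<close> and
  \<open>B C X\<close>, each of which needs two deletions.\<close>

lemma card_free_labels_le: "2 * card (free_labels T) \<le> card T"
proof -
  have F: "card (free_labels T) = of_bool (A \<in> free_labels T) + of_bool (C \<in> free_labels T)"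
    using free_labels_subset[of T] unfolding card_role_set by auto
  have A: "A \<in> free_labels T \<longleftrightarrow>
      ((A \<notin> T \<or> B \<notin> T \<or> P \<notin> T) \<and> \<not> (left_anchored T \<or> linked T \<and> right_anchored T)) \<or>
      ((C \<notin> T \<or> D \<notin> T \<or> Q \<notin> T) \<and> \<not> (right_anchored T \<or> linked T \<and> left_anchored T) \<and> linked T)"
    by (auto simp: free_labels_def component_label_def image_iff Bex_def ex_role)
  have C: "C \<in> free_labels T \<longleftrightarrow>
      (C \<notin> T \<or> D \<notin> T \<or> Q \<notin> T) \<and> \<not> (right_anchored T \<or> linked T \<and> left_anchored T) \<and> \<not> linked T"
    by (auto simp: free_labels_def component_label_def image_iff Bex_def ex_role)
  show ?thesis
    unfolding F card_role_set[of T] A C left_anchored_def right_anchored_def linked_def avoids_def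
    by (cases "A \<in> T"; cases "B \<in> T"; cases "C \<in> T"; cases "D \<in> T"; simp)
qed

text \<open>\<open>R\<close> is abstract so that it can become reachability in the whole graph. What
  remains of a triangle is connected, and surviving linking or anchoring edges supply the
  rest.\<close>

lemma component_label_connected:
  assumes step: "\<And>r s. \<lbrakk>r \<notin> T; s \<notin> T; gadget_adj r s\<rbrakk> \<Longrightarrow> R r s"
    and refl: "\<And>r. R r r" and trans: "\<And>r s t. \<lbrakk>R r s; R s t\<rbrakk> \<Longrightarrow> R r t"
    and r: "r \<notin> T"
  shows "component_label T r = X \<Longrightarrow> \<exists>s \<in> {X, Y} - T. R r s" (is "_ \<Longrightarrow> ?anchored r")
    and "\<lbrakk>component_label T r \<noteq> X; s \<notin> T; component_label T s = component_label T r\<rbrakk> \<Longrightarrow> R r s"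
proof -
  have left: "R r s" if "r \<in> {A, B, P} - T" "s \<in> {A, B, P} - T" for r s
    using that step[of r s] refl by auto
  have right: "R r s" if "r \<in> {C, D, Q} - T" "s \<in> {C, D, Q} - T" for r s
    using that step[of r s] refl by auto
  \<comment> \<open>\<open>R\<close> is not assumed to be symmetric, so both directions are
    recorded.\<close>
  have link: "R r s \<and> R s r" if "r \<in> {A, B, P} - T" "s \<in> {C, D, Q} - T" "linked T" for r s
  proof -
    have "\<exists>a \<in> {A, B, P} - T. \<exists>c \<in> {C, D, Q} - T. R a c \<and> R c a"
      using that(3) step[of A D] step[of D A] step[of B C] step[of C B]
      by (auto simp: linked_def avoids_def)
    then show ?thesis
      using that left right trans by meson
  qed
  have anchor_left: "?anchored r" if "r \<in> {A, B, P} - T" "left_anchored T" for r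
  proof -
    have "\<exists>a \<in> {A, B, P} - T. ?anchored a"
      using that(2) step[of A Y] step[of B X] by (auto simp: left_anchored_def avoids_def)
    then show ?thesis
      using that left trans by meson
  qed
  have anchor_right: "?anchored r" if "r \<in> {C, D, Q} - T" "right_anchored T" for r
  proof -
    have "\<exists>c \<in> {C, D, Q} - T. ?anchored c"
      using that(2) step[of D Y] step[of C X] by (auto simp: right_anchored_def avoids_def)
    then show ?thesis
      using that right trans by meson
  qed
  have left_right: "(\<exists>s. s \<in> {A, B, P} - T) \<and> (\<exists>s. s \<in> {C, D, Q} - T)" if "linked T"
    using that by (auto simp: linked_def avoids_def)
  have side: "r \<in> {X, Y} \<or> r \<in> {A, B, P} \<or> r \<in> {C, D, Q}" for r
    by (cases r) auto
  show "?anchored r" if anchored: "component_label T r = X"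
  proof -
    consider "r \<in> {X, Y}" | "r \<in> {A, B, P}" "left_anchored T \<or> linked T \<and> right_anchored T"
      | "r \<in> {C, D, Q}" "right_anchored T \<or> linked T \<and> left_anchored T"
      using anchored side[of r] by (auto simp: component_label_def split: if_splits)
    then show ?thesis
    proof cases
      case 1
      then show ?thesis
        using r refl by blast
    next
      case 2
      then show ?thesis
        using r anchor_left anchor_right link left_right trans by (meson DiffI)
    next
      case 3
      then show ?thesis
        using r anchor_left anchor_right link left_right trans by (meson DiffI)
    qed
  qed
  show "R r s" if "component_label T r \<noteq> X" "s \<notin> T" "component_label T s = component_label T r"
  proof -
    have "r \<in> {A, B, P} \<and> s \<in> {A, B, P} \<or> r \<in> {C, D, Q} \<and> s \<in> {C, D, Q} \<or>
      linked T \<and> (r \<in> {A, B, P} \<and> s \<in> {C, D, Q} \<or> s \<in> {A, B, P} \<and> r \<in> {C, D, Q})"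
      using that side[of r] side[of s] by (auto simp: component_label_def split: if_splits)
    then show ?thesis
      using r that(2) left right link by (meson DiffI)
  qed
qed

subsection \<open>Toughness of the construction\<close>

definition traces :: "vertex set \<Rightarrow> nat \<Rightarrow> role set" where
  "traces S i = {r. Gad i r \<in> S}"

text \<open>\<open>Hub 0\<close> labels the component of the clique of all \<open>X\<close> and \<open>Y\<close>, even if \<open>l = 0\<close>.\<close>
fun component_rep :: "vertex set \<Rightarrow> vertex \<Rightarrow> vertex" where
  "component_rep S (Hub i) = Hub i"
| "component_rep S (Leaf i) = Leaf i"
| "component_rep S (Gad i r) =
     (let s = component_label (traces S i) r in if s = X then Hub 0 else Gad i s)"

context
  fixes l n m :: nat and S :: "vertex set"
  assumes S: "S \<subseteq> vertices l n m"
begin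

abbreviation adj_avoiding :: "vertex \<Rightarrow> vertex \<Rightarrow> bool" where
  "adj_avoiding u v \<equiv> u \<in> vertices l n m - S \<and> v \<in> vertices l n m - S \<and> adj u v"

lemma reachable_if_hub_left:
  assumes "Hub j \<in> vertices l n m - S" "u \<in> vertices l n m - S" "v \<in> vertices l n m - S"
  shows "adj_avoiding\<^sup>*\<^sup>* u v"
proof -
  have "adj_avoiding\<^sup>*\<^sup>* u (Hub j)"
    using assms adj_sym[of "Hub j" u] by (cases "u = Hub j") auto
  moreover have "adj_avoiding\<^sup>*\<^sup>* (Hub j) v"
    using assms by (cases "v = Hub j") auto
  ultimately show ?thesis
    by (rule rtranclp_trans)
qed

text \<open>The label \<open>Hub 0\<close> gives a path to a surviving \<open>X\<close> or
  \<open>Y\<close>, and those form a clique across all gadgets. Any other gadget label fixes the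
  gadget and a component inside it; a leaf is alone with its label.\<close>

lemma reachable_if_same_rep:
  assumes hubs: "Hub ` {..<l} \<subseteq> S"
    and u: "u \<in> vertices l n m - S" and v: "v \<in> vertices l n m - S"
    and eq: "component_rep S u = component_rep S v"
  shows "adj_avoiding\<^sup>*\<^sup>* u v"
proof -
  define W where "W = vertices l n m - S"
  define R where "R = adj_avoiding\<^sup>*\<^sup>*"
  have R_refl: "R w w" for w
    by (simp add: R_def)
  have R_trans: "R u w" if "R u v" "R v w" for u v w
    using that unfolding R_def by (rule rtranclp_trans)
  have R_adj: "R u v" if "u \<in> W" "v \<in> W" "adj u v" for u v
    using that unfolding R_def W_def by (intro r_into_rtranclp conjI)
  have "symp adj_avoiding"
    using adj_sym by (auto simp: symp_def)
  then have R_sym: "R v u" if "R u v" for u v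
    using that unfolding R_def by (rule sympD[OF symp_rtranclp])
  have no_hub: "Hub j \<notin> W" for j
    using hubs by (auto simp: W_def vertices_def)
  have gad: "Gad i r \<in> W \<longleftrightarrow> i < m \<and> r \<notin> traces S i" for i r
    by (auto simp: W_def vertices_def traces_def)
  have step: "R (Gad i r) (Gad i s)"
    if "i < m" "r \<notin> traces S i" "s \<notin> traces S i" "gadget_adj r s" for i r s
    using that by (intro R_adj) (simp_all add: gad)
  have anchor: "\<exists>s \<in> {X, Y} - traces S i. R (Gad i r) (Gad i s)"
    if "i < m" "r \<notin> traces S i" "component_label (traces S i) r = X" for i r
    using step[OF that(1)] R_refl R_trans that(2,3)
    by (rule component_label_connected(1)[where R = "\<lambda>r s. R (Gad i r) (Gad i s)"])
  have same: "R (Gad i r) (Gad i s)"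
    if "i < m" "r \<notin> traces S i" "component_label (traces S i) r \<noteq> X" "s \<notin> traces S i"
      "component_label (traces S i) s = component_label (traces S i) r" for i r s
    using step[OF that(1)] R_refl R_trans that(2-5)
    by (rule component_label_connected(2)[where R = "\<lambda>r s. R (Gad i r) (Gad i s)"])
  have anchored: "\<exists>j s. s \<in> {X, Y} \<and> Gad j s \<in> W \<and> R w (Gad j s)"
    if w: "w \<in> W" "component_rep S w = Hub 0" for w
  proof (cases w)
    case (Hub j)
    with w(1) no_hub show ?thesis
      by simp
  next
    case (Leaf j)
    with w(2) show ?thesis
      by simp
  next
    case (Gad i r)
    then have ir: "i < m" "r \<notin> traces S i"
      using w(1) gad by simp_all
    moreover have "component_label (traces S i) r = X"
      using w(2) Gad by (simp add: Let_def split: if_splits)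
    ultimately obtain s where "s \<in> {X, Y} - traces S i" "R w (Gad i s)"
      using anchor Gad by blast
    then show ?thesis
      using gad ir(1) by blast
  qed
  have "R u v"
  proof (cases "component_rep S u = Hub 0")
    case True
    obtain i r where r: "r \<in> {X, Y}" "Gad i r \<in> W" "R u (Gad i r)"
      using anchored u True unfolding W_def by blast
    obtain j s where s: "s \<in> {X, Y}" "Gad j s \<in> W" "R v (Gad j s)"
      using anchored v True eq unfolding W_def by metis
    have "R (Gad i r) (Gad j s)"
    proof (cases "Gad i r = Gad j s")
      case False
      then show ?thesis
        using r(1,2) s(1,2) by (intro R_adj) simp_all
    qed (simp add: R_refl)
    then show ?thesis
      using r(3) s(3) R_trans R_sym by blast
  next
    case False
    show ?thesis
    proof (cases u)
      case (Hub j)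
      then show ?thesis
        using u no_hub unfolding W_def by blast
    next
      case (Leaf j)
      then have "component_rep S v = Leaf j"
        using eq by simp
      then have "v = u"
        unfolding Leaf by (cases v) (simp_all add: Let_def split: if_splits)
      then show ?thesis
        by (simp add: R_refl)
    next
      case (Gad i r)
      then have r: "component_label (traces S i) r \<noteq> X"
        "component_rep S v = Gad i (component_label (traces S i) r)"
        using False eq by (simp_all add: Let_def split: if_splits)
      then obtain s where s: "v = Gad i s" "component_label (traces S i) s = component_label (traces S i) r"
        by (cases v) (simp_all add: Let_def split: if_splits)
      have "i < m" "r \<notin> traces S i" "s \<notin> traces S i"
        using u v gad unfolding Gad s(1) W_def by blast+
      then show ?thesis
        unfolding Gad s(1) using r(1) s(2) by (intro same)
    qed
  qed
  then show ?thesis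
    by (simp add: R_def)
qed

text \<open>The possible labels are \<open>Hub 0\<close>, the \<open>n\<close> leaves and the free
  labels of each gadget; \<open>Hub 0\<close> is counted whether or not a vertex carries it.\<close>

lemma card_component_reps_le:
  assumes hubs: "Hub ` {..<l} \<subseteq> S"
  shows "card (component_rep S ` (vertices l n m - S)) \<le> 1 + n + (\<Sum>i<m. card (free_labels (traces S i)))"
proof -
  let ?F = "\<lambda>i. Gad i ` free_labels (traces S i)"
  have "component_rep S v \<in> {Hub 0} \<union> Leaf ` {..<n} \<union> (\<Union>i<m. ?F i)" if v: "v \<in> vertices l n m - S" for v
  proof (cases v)
    case (Gad i r)
    then have "i < m" "r \<notin> traces S i"
      using v by (auto simp: vertices_def traces_def)
    then show ?thesis
      using Gad by (auto simp: Let_def free_labels_def)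
  qed (use v hubs in \<open>auto simp: vertices_def\<close>)
  then have "card (component_rep S ` (vertices l n m - S)) \<le> card ({Hub 0} \<union> Leaf ` {..<n} \<union> (\<Union>i<m. ?F i))"
    by (intro card_mono) auto
  also have "\<dots> \<le> card ({Hub 0} \<union> Leaf ` {..<n}) + card (\<Union>i<m. ?F i)"
    by (rule card_Un_le)
  also have "card ({Hub 0} \<union> Leaf ` {..<n}) \<le> 1 + n"
    using card_Un_le[of "{Hub 0}" "Leaf ` {..<n}"] card_image_le[of "{..<n}" Leaf] by simp
  also have "card (\<Union>i<m. ?F i) \<le> (\<Sum>i<m. card (?F i))"
    by (intro card_UN_le) simp
  also have "\<dots> \<le> (\<Sum>i<m. card (free_labels (traces S i)))"
    by (intro sum_mono card_image_le) simp
  finally show ?thesis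
    by simp
qed

lemma card_ge_traces:
  assumes hubs: "Hub ` {..<l} \<subseteq> S"
  shows "l + (\<Sum>i<m. card (traces S i)) \<le> card S"
proof -
  let ?U = "\<Union>i<m. Gad i ` traces S i"
  have "card ?U = (\<Sum>i<m. card (Gad i ` traces S i))"
    by (intro card_UN_disjoint) auto
  also have "\<dots> = (\<Sum>i<m. card (traces S i))"
    by (intro sum.cong card_image) (auto simp: inj_on_def)
  finally have "l + (\<Sum>i<m. card (traces S i)) = card (Hub ` {..<l}) + card ?U"
    by (simp add: card_image inj_on_def)
  also have "\<dots> = card (Hub ` {..<l} \<union> ?U)"
    by (intro card_Un_disjoint[symmetric]) auto
  also have "\<dots> \<le> card S"
    using hubs finite_subset[OF S finite_vertices] by (intro card_mono) (auto simp: traces_def)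
  finally show ?thesis .
qed

end

text \<open>The total number \<open>k\<close> of free labels links both counts: at most
  \<open>1 + n + k\<close> components against at least \<open>l + 2 * k\<close> deleted vertices.
  Each gadget has at most two free labels, so \<open>k <= 2 * m\<close>.\<close>

lemma tough_nat_graph_vertices:
  assumes t: "0 \<le> t" and bound: "\<And>k. k \<le> 2 * m \<Longrightarrow> t * real (1 + n + k) \<le> real (l + 2 * k)"
  shows "tough t (with_proj (nat_graph (vertices l n m) adj))"
  unfolding tough_def
proof (intro allI impI)
  let ?V = "vertices l n m" and ?G = "with_proj (nat_graph (vertices l n m) adj)"
  fix S' assume S': "S' \<subseteq> verts ?G" and comps: "num_components (delete_vertices ?G S') > 1"
  then obtain S where S: "S \<subseteq> ?V" "S' = to_nat ` S"
    by (auto simp: nat_graph_def subset_image_iff)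
  note upper = num_components_nat_graph_le_card_image[OF finite_vertices symp_adj irreflp_adj]
  have hubs: "Hub ` {..<l} \<subseteq> S"
  proof (rule ccontr)
    assume "\<not> Hub ` {..<l} \<subseteq> S"
    then obtain j where j: "Hub j \<in> ?V - S"
      by (auto simp: vertices_def)
    have "num_components (delete_vertices ?G S') \<le> card ((\<lambda>v. 0::nat) ` (?V - S))"
      unfolding S(2) by (rule upper) (rule reachable_if_hub_left[OF S(1) j])
    also have "\<dots> \<le> 1"
      by (simp add: image_constant_conv)
    finally show False
      using comps by simp
  qed
  let ?k = "\<Sum>i<m. card (free_labels (traces S i))"
  have "num_components (delete_vertices ?G S') \<le> card (component_rep S ` (?V - S))"
    unfolding S(2) by (rule upper) (rule reachable_if_same_rep[OF S(1) hubs])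
  also have "\<dots> \<le> 1 + n + ?k"
    using S(1) hubs by (rule card_component_reps_le)
  finally have "t * real (num_components (delete_vertices ?G S')) \<le> t * real (1 + n + ?k)"
    using t by (intro mult_left_mono of_nat_mono)
  also have "card (free_labels T) \<le> 2" for T
    using card_mono[OF _ free_labels_subset[of T]] by simp
  then have "?k \<le> (\<Sum>i<m. 2)"
    by (intro sum_mono)
  then have "t * real (1 + n + ?k) \<le> real (l + 2 * ?k)"
    by (intro bound) simp
  also have "2 * ?k \<le> (\<Sum>i<m. card (traces S i))"
    unfolding sum_distrib_left by (intro sum_mono card_free_labels_le)
  then have "l + 2 * ?k \<le> card S"
    using card_ge_traces[OF S(1) hubs] by linarith
  then have "real (l + 2 * ?k) \<le> real (card S)"
    by (rule of_nat_mono)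
  also have "card S = card S'"
    by (simp add: S(2) card_image)
  finally show "t * real (num_components (delete_vertices ?G S')) \<le> real (card S')" .
qed

section \<open>Separating sets that bound the toughness from above\<close>

lemma toughness_le_nat_graph:
  fixes V :: "'a::countable set"
  assumes "finite V" "symp E" "irreflp E"
    and S: "S \<subseteq> V" and f: "\<And>u v. \<lbrakk>u \<in> V - S; v \<in> V - S; E u v\<rbrakk> \<Longrightarrow> f u = f v"
    and k: "k \<le> card (f ` (V - S))" "2 \<le> k" and t: "real (card S) \<le> t * real k" "0 \<le> t"
  shows "toughness (with_proj (nat_graph V E)) \<le> ereal t"
proof -
  let ?c = "num_components (delete_vertices (with_proj (nat_graph V E)) (to_nat ` S))"
  have "k \<le> ?c"
    \<comment> \<open>A lower bound on the number of components is enough, as more components only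
      lower the ratio.\<close>
    using card_image_le_num_components_nat_graph[OF assms(1-3) f] k(1) by (rule order_trans[rotated])
  have "toughness (with_proj (nat_graph V E)) \<le> ereal (real (card (to_nat ` S)) / real ?c)"
    unfolding toughness_def using S \<open>k \<le> ?c\<close> k(2) by (intro INF_lower) (auto simp: nat_graph_def)
  also have "real (card S) \<le> t * real ?c"
    using t \<open>k \<le> ?c\<close> by (meson mult_left_mono of_nat_mono order_trans)
  then have "ereal (real (card (to_nat ` S)) / real ?c) \<le> ereal t"
    using \<open>k \<le> ?c\<close> k(2) by (simp add: card_image divide_le_eq)
  finally show ?thesis .
qed

text \<open>Labels for deleting the hubs alone: the leaves become isolated and all gadgets share one
  label.\<close>

fun leaf_class :: "vertex \<Rightarrow> vertex" where
  "leaf_class (Leaf i) = Leaf i"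
| "leaf_class v = Hub 0"

text \<open>Labels for deleting the hubs and every \<open>A\<close>, \<open>B\<close>,
  \<open>C\<close>, \<open>D\<close>: each leaf, \<open>P\<close> and \<open>Q\<close> becomes
  isolated, and the \<open>X\<close> and \<open>Y\<close> form one clique.\<close>

fun apex_class :: "vertex \<Rightarrow> vertex" where
  "apex_class (Leaf i) = Leaf i"
| "apex_class (Gad i r) = (if r \<in> {P, Q} then Gad i r else Hub 0)"
| "apex_class v = Hub 0"

lemma toughness_nat_graph_vertices:
  assumes "0 < m" "0 < n" "0 \<le> t"
    and bound: "\<And>k. k \<le> 2 * m \<Longrightarrow> t * real (1 + n + k) \<le> real (l + 2 * k)"
    and attained: "real l = t * real (1 + n) \<or> real (l + 4 * m) = t * real (1 + n + 2 * m)"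
  shows "toughness (with_proj (nat_graph (vertices l n m) adj)) = ereal t"
proof (rule antisym)
  let ?V = "vertices l n m" and ?hubs = "Hub ` {..<l}"
  note le = toughness_le_nat_graph[OF finite_vertices symp_adj irreflp_adj]
  show "ereal t \<le> toughness (with_proj (nat_graph ?V adj))"
    using tough_nat_graph_vertices[OF assms(3) bound] by (simp add: tough_iff_le_toughness)
  from attained show "toughness (with_proj (nat_graph ?V adj)) \<le> ereal t"
  proof
    assume eq: "real l = t * real (1 + n)"
    \<comment> \<open>\<open>Gad 0 A\<close> exists since \<open>0 < m\<close> and supplies the
      label \<open>Hub 0\<close>.\<close>
    have "Gad 0 A \<in> ?V - ?hubs" "\<And>j. j < n \<Longrightarrow> Leaf j \<in> ?V - ?hubs"
      using assms(1) by (auto simp: vertices_def)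
    then have "leaf_class (Gad 0 A) \<in> leaf_class ` (?V - ?hubs)"
      "\<And>j. j < n \<Longrightarrow> leaf_class (Leaf j) \<in> leaf_class ` (?V - ?hubs)"
      by (blast intro: imageI)+
    then have "{Hub 0} \<union> Leaf ` {..<n} \<subseteq> leaf_class ` (?V - ?hubs)"
      by auto
    then have "card ({Hub 0} \<union> Leaf ` {..<n}) \<le> card (leaf_class ` (?V - ?hubs))"
      using finite_vertices by (intro card_mono) auto
    moreover have "card ({Hub 0} \<union> Leaf ` {..<n}) = 1 + n"
      by (subst card_Un_disjoint) (auto simp: card_image inj_on_def)
    ultimately have "1 + n \<le> card (leaf_class ` (?V - ?hubs))"
      by simp
    then show ?thesis
    proof (rule le[rotated 2])
      show "?hubs \<subseteq> ?V"
        by (auto simp: vertices_def)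
      show "leaf_class u = leaf_class v" if "u \<in> ?V - ?hubs" "v \<in> ?V - ?hubs" "adj u v" for u v
        using that by (cases u; cases v) (auto simp: vertices_def)
      show "real (card ?hubs) \<le> t * real (1 + n)"
        using eq by (simp add: card_image inj_on_def)
    qed (use assms in auto)
  next
    assume eq: "real (l + 4 * m) = t * real (1 + n + 2 * m)"
    \<comment> \<open>The case \<open>k = 2 * m\<close>: four deletions per gadget gain two
      components.\<close>
    define S where "S = ?hubs \<union> case_prod Gad ` ({..<m} \<times> {A, B, C, D})"
    have S: "S \<subseteq> ?V"
      by (auto simp: S_def vertices_def)
    have card_S: "card S = l + 4 * m"
      unfolding S_def by (subst card_Un_disjoint) (auto simp: card_image inj_on_def card_cartesian_product)
    let ?R = "{Hub 0} \<union> Leaf ` {..<n} \<union> case_prod Gad ` ({..<m} \<times> {P, Q})"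
    have "Gad 0 X \<in> ?V - S" "\<And>j. j < n \<Longrightarrow> Leaf j \<in> ?V - S"
      "\<And>i. i < m \<Longrightarrow> Gad i P \<in> ?V - S" "\<And>i. i < m \<Longrightarrow> Gad i Q \<in> ?V - S"
      using assms(1) by (auto simp: vertices_def S_def)
    then have "apex_class (Gad 0 X) \<in> apex_class ` (?V - S)"
      "\<And>j. j < n \<Longrightarrow> apex_class (Leaf j) \<in> apex_class ` (?V - S)"
      "\<And>i. i < m \<Longrightarrow> apex_class (Gad i P) \<in> apex_class ` (?V - S)"
      "\<And>i. i < m \<Longrightarrow> apex_class (Gad i Q) \<in> apex_class ` (?V - S)"
      by (blast intro: imageI)+
    then have "?R \<subseteq> apex_class ` (?V - S)"
      by auto
    then have "card ?R \<le> card (apex_class ` (?V - S))"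
      using finite_vertices by (intro card_mono) auto
    moreover have "card ?R = 1 + n + 2 * m"
      by (subst card_Un_disjoint; (subst card_Un_disjoint)?)
        (auto simp: card_image inj_on_def card_cartesian_product)
    ultimately have "1 + n + 2 * m \<le> card (apex_class ` (?V - S))"
      by simp
    then show ?thesis
    proof (rule le[OF S, rotated])
      show "apex_class u = apex_class v" if uv: "u \<in> ?V - S" "v \<in> ?V - S" "adj u v" for u v
      proof -
        have no_hub: "Hub j \<notin> ?V - S" for j
          by (auto simp: S_def vertices_def)
        have gad: "r \<notin> {A, B, C, D}" if "Gad i r \<in> ?V - S" for i r
          using that by (auto simp: S_def vertices_def)
        show ?thesis
        proof (cases u)
          case u: (Gad i r)
          show ?thesis
          proof (cases v)
            case v: (Gad j s)
            show ?thesis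
              using gad[of i r] gad[of j s] uv unfolding u v by (cases r) auto
          qed (use uv no_hub u in auto)
        qed (use uv no_hub in auto)
      qed
      show "real (card S) \<le> t * real (1 + n + 2 * m)"
        using eq by (simp add: card_S)
    qed (use assms in auto)
  qed
qed

lemma not_hamiltonian_nat_graph_vertices:
  assumes "2 * l < m" "0 < n"
  shows "\<not> hamiltonian (with_proj (nat_graph (vertices l n m) adj))"
  using no_connected_2_factor[OF assms]
  by (rule not_hamiltonian_nat_graph[OF finite_vertices symp_adj irreflp_adj])

text \<open>The slack \<open>l + 2 * k - t * (1 + n + k)\<close> changes by \<open>2 - t\<close>
  when \<open>k\<close> grows by one, so only one end of the range is critical: \<open>k = 0\<close>
  if \<open>t <= 2\<close>, and \<open>k = 2 * m\<close> otherwise.\<close>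

lemma exists_parameters:
  fixes t :: real
  assumes "t \<in> \<rat>" and "0 < t" and "t < 9 / 4"
  shows "\<exists>l n m. 2 * l < m \<and> 0 < n \<and>
      (\<forall>k \<le> 2 * m. t * real (1 + n + k) \<le> real (l + 2 * k)) \<and>
      (real l = t * real (1 + n) \<or> real (l + 4 * m) = t * real (1 + n + 2 * m))"
proof (cases "t \<le> 2")
  case True
  obtain p q :: nat where q: "q \<noteq> 0" "t = real p / real q"
    using assms(1,2) by (metis Rats_abs_nat_div_natE abs_of_pos)
  \<comment> \<open>The fraction \<open>p / q\<close> is expanded by 2, giving
    \<open>l = 2 * p\<close> and \<open>1 + n = 2 * q\<close>, so that \<open>n\<close> is positive
    even for \<open>q = 1\<close>.\<close>
  have "t * real (1 + (2 * q - 1) + k) \<le> real (2 * p + 2 * k)" for k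
  proof -
    have "t * real (1 + (2 * q - 1) + k) = real (2 * p) + t * real k"
      using q by (simp add: field_simps)
    then show ?thesis
      using mult_right_mono[OF True, of "real k"] by simp
  qed
  moreover have "real (2 * p) = t * real (1 + (2 * q - 1))"
    using q by (simp add: field_simps)
  ultimately show ?thesis
    using q by (intro exI[of _ "2 * p"] exI[of _ "2 * q - 1"] exI[of _ "4 * p + 1"]) auto
next
  case False
  have "t - 2 \<in> \<rat>" "\<bar>t - 2\<bar> = t - 2"
    using assms(1) False by auto
  then obtain a b :: nat where b: "b \<noteq> 0" "t - 2 = real a / real b"
    by (metis Rats_abs_nat_div_natE)
  have "real a / real b < 1 / 4"
    using assms(3) b(2) by linarith
  then have "real (4 * a) < real b"
    using b(1) by (simp add: field_simps)
  then have ab: "4 * a < b"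
    by linarith
  \<comment> \<open>With \<open>n = 1\<close> and \<open>t = 2 + a / b\<close>, equality at
    \<open>k = 2 * m\<close> means \<open>l = 4 + a / b * (2 + 2 * m)\<close>; taking
    \<open>2 + 2 * m = 20 * b\<close> makes this an integer. Then \<open>2 * l < m\<close> reads
    \<open>40 * a + 9 < 10 * b\<close>, which follows from \<open>4 * a + 1 <= b\<close>, that is,
    from \<open>t < 9 / 4\<close>.\<close>
  define l m where "l = 4 + 20 * a" and "m = 10 * b - 1"
  have m: "real m = 10 * real b - 1"
    using b by (simp add: m_def)
  have eq: "real (l + 4 * m) = t * real (1 + 1 + 2 * m)"
    using b by (simp add: l_def m) (simp add: field_simps)
  have "t * real (1 + 1 + k) \<le> real (l + 2 * k)" if "k \<le> 2 * m" for k
  proof -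
    have "(t - 2) * real k \<le> (t - 2) * real (2 * m)"
      using that False by (intro mult_left_mono) simp_all
    then show ?thesis
      using eq by (simp add: algebra_simps)
  qed
  moreover have "2 * l < m"
    using ab by (simp add: l_def m_def)
  ultimately show ?thesis
    using eq by (intro exI[of _ l] exI[of _ 1] exI[of _ m]) simp
qed

theorem theorem1:
  fixes t :: real
  assumes "t \<in> \<rat>" and "0 < t" and "t < 9 / 4"
  shows "\<exists>G :: nat pair_pre_digraph. pair_graph G \<and>
           \<not> hamiltonian (with_proj G) \<and> toughness (with_proj G) = ereal t"
proof -
  obtain l n m where lnm: "2 * l < m" "0 < n"
    "\<forall>k \<le> 2 * m. t * real (1 + n + k) \<le> real (l + 2 * k)"
    "real l = t * real (1 + n) \<or> real (l + 4 * m) = t * real (1 + n + 2 * m)"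
    using exists_parameters[OF assms] by blast
  have "toughness (with_proj (nat_graph (vertices l n m) adj)) = ereal t"
    using lnm assms(2) by (intro toughness_nat_graph_vertices) auto
  moreover have "pair_graph (nat_graph (vertices l n m) adj)"
    using finite_vertices symp_adj irreflp_adj by (rule pair_graph_nat_graph)
  ultimately show ?thesis
    using not_hamiltonian_nat_graph_vertices[OF lnm(1,2)] by blast
qed

end
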